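(* Let $q=W+X\boldsymbol{i}+Y\boldsymbol{j}+Z\boldsymbol{k}$ be a non-zero biquaternion, with $W,X,Y,Z\in\mathbb{C}$, and write $q=q_r+I q_i$ with $q_r,q_i\in\mathbb{H}$. Then the two conditions $$\|q_r\|=\|q_i\|\quad\text{and}\quad\langle q_r,q_i\rangle=0$$ hold if and only if $\|q\|=W^2+X^2+Y^2+Z^2=0$.
   Context: Biquaternions are quaternions with complex coefficients, $q=W+X\boldsymbol{i}+Y\boldsymbol{j}+Z\boldsymbol{k}$ with $W,X,Y,Z\in\mathbb{C}$, where $\boldsymbol{i},\boldsymbol{j},\boldsymbol{k}$ are the usual quaternion units. $\mathbb{H}$ denotes the real quaternions. The square root of $-1$ in $\mathbb{C}$ is denoted $I$; it is distinct from $\boldsymbol{i}$ and commutes with all biquaternions. Every biquaternion is uniquely $q=q_r+Iq_i$ with $q_r=w_r+x_r\boldsymbol{i}+y_r\boldsymbol{j}+z_r\boldsymbol{k}$ and $q_i=w_i+x_i\boldsymbol{i}+y_i\boldsymbol{j}+z_i\boldsymbol{k}$ in $\mathbb{H}$, where $W=w_r+Iw_i$, and similarly for $X,Y,Z$. The norm of a real quaternion $w+x\boldsymbol{i}+y\boldsymbol{j}+z\boldsymbol{k}$ is $w^2+x^2+y^2+z^2$ (no square root); the semi-norm of a biquaternion is $\|q\|=W^2+X^2+Y^2+Z^2\in\mathbb{C}$. The inner product is $\langle q_r,q_i\rangle=w_rw_i+x_rx_i+y_ry_i+z_rz_i$. *)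

theory Defs
  imports Complex_Main
begin

text \<open>Quaternions over a commutative ring of scalars. Over the reals this is the division algebra
  of real quaternions, over the complex numbers the algebra of biquaternions.\<close>

datatype 'a quaternion =
  Quaternion (re_part: 'a) (i_part: 'a) (j_part: 'a) (k_part: 'a)

type_synonym real_quaternion = "real quaternion"
type_synonym biquaternion = "complex quaternion"

lemma quaternion_eq_iff:
  "p = q \<longleftrightarrow> re_part p = re_part q \<and> i_part p = i_part q \<and> j_part p = j_part q \<and> k_part p = k_part q"
  by (cases p; cases q) simp

instantiation quaternion :: (comm_ring_1) ring_1
begin

definition zero_quaternion :: "'a quaternion" where
  "0 = Quaternion 0 0 0 0"

definition one_quaternion :: "'a quaternion" where
  "1 = Quaternion 1 0 0 0"

definition plus_quaternion :: "'a quaternion \<Rightarrow> 'a quaternion \<Rightarrow> 'a quaternion" where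
  "p + q = Quaternion (re_part p + re_part q) (i_part p + i_part q)
                      (j_part p + j_part q) (k_part p + k_part q)"

definition uminus_quaternion :: "'a quaternion \<Rightarrow> 'a quaternion" where
  "- p = Quaternion (- re_part p) (- i_part p) (- j_part p) (- k_part p)"

definition minus_quaternion :: "'a quaternion \<Rightarrow> 'a quaternion \<Rightarrow> 'a quaternion" where
  "p - q = Quaternion (re_part p - re_part q) (i_part p - i_part q)
                      (j_part p - j_part q) (k_part p - k_part q)"

definition times_quaternion :: "'a quaternion \<Rightarrow> 'a quaternion \<Rightarrow> 'a quaternion" where
  "p * q = Quaternion
     (re_part p * re_part q - i_part p * i_part q - j_part p * j_part q - k_part p * k_part q)
     (re_part p * i_part q + i_part p * re_part q + j_part p * k_part q - k_part p * j_part q)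
     (re_part p * j_part q - i_part p * k_part q + j_part p * re_part q + k_part p * i_part q)
     (re_part p * k_part q + i_part p * j_part q - j_part p * i_part q + k_part p * re_part q)"

lemmas quaternion_arith_defs =
  zero_quaternion_def one_quaternion_def plus_quaternion_def uminus_quaternion_def
  minus_quaternion_def times_quaternion_def

instance
  by standard (simp_all add: quaternion_arith_defs quaternion_eq_iff algebra_simps)

end

definition quat_i :: "'a::comm_ring_1 quaternion" where
  "quat_i = Quaternion 0 1 0 0"

definition quat_j :: "'a::comm_ring_1 quaternion" where
  "quat_j = Quaternion 0 0 1 0"

definition quat_k :: "'a::comm_ring_1 quaternion" where
  "quat_k = Quaternion 0 0 0 1"

definition quat_of_scalar :: "'a::comm_ring_1 \<Rightarrow> 'a quaternion" where
  "quat_of_scalar c = Quaternion c 0 0 0"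

definition biquat_of_real_quat :: "real_quaternion \<Rightarrow> biquaternion" where
  "biquat_of_real_quat = map_quaternion complex_of_real"

text \<open>The central square root of \<open>-1\<close>, i.e. the scalar \<open>\<i>\<close>; not to be confused with the
  quaternion unit \<^const>\<open>quat_i\<close>.\<close>

definition biquat_I :: biquaternion where
  "biquat_I = quat_of_scalar \<i>"

text \<open>No square root is taken. Over the reals this is the norm of a quaternion; over the complex
  numbers it is the complex-valued semi-norm (squares, not squared moduli).\<close>

definition quat_norm :: "'a::comm_ring_1 quaternion \<Rightarrow> 'a" where
  "quat_norm q = (re_part q)\<^sup>2 + (i_part q)\<^sup>2 + (j_part q)\<^sup>2 + (k_part q)\<^sup>2"

definition quat_inner :: "real_quaternion \<Rightarrow> real_quaternion \<Rightarrow> real" where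
  "quat_inner p q = re_part p * re_part q + i_part p * i_part q
                  + j_part p * j_part q + k_part p * k_part q"

lemmas quaternion_defs =
  quaternion_arith_defs quat_i_def quat_j_def quat_k_def quat_of_scalar_def biquat_I_def

lemma quaternion_unit_products:
  "quat_i * quat_i = (- 1 :: 'a::comm_ring_1 quaternion)"
  "quat_j * quat_j = (- 1 :: 'a quaternion)"
  "quat_k * quat_k = (- 1 :: 'a quaternion)"
  "quat_i * quat_j = (quat_k :: 'a quaternion)"
  "quat_j * quat_k = (quat_i :: 'a quaternion)"
  "quat_k * quat_i = (quat_j :: 'a quaternion)"
  "quat_j * quat_i = - (quat_k :: 'a quaternion)"
  "quat_k * quat_j = - (quat_i :: 'a quaternion)"
  "quat_i * quat_k = - (quat_j :: 'a quaternion)"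
  by (simp_all add: quaternion_defs)

lemma quaternion_basis_form:
  "quat_of_scalar w + quat_of_scalar x * quat_i + quat_of_scalar y * quat_j + quat_of_scalar z * quat_k
     = Quaternion w x y z"
  by (simp add: quaternion_defs)

lemma biquat_I_square: "biquat_I * biquat_I = - 1"
  by (simp add: quaternion_defs)

lemma biquat_I_commute: "biquat_I * q = q * biquat_I"
  by (simp add: quaternion_defs mult.commute)

lemma biquat_decomposition_exists_unique:
  "\<exists>!(q\<^sub>r, q\<^sub>i). q = biquat_of_real_quat q\<^sub>r + biquat_I * biquat_of_real_quat q\<^sub>i"
proof -
  have eq: "q = biquat_of_real_quat a + biquat_I * biquat_of_real_quat b \<longleftrightarrow>
      a = map_quaternion Re q \<and> b = map_quaternion Im q" for a b
    by (cases q; cases a; cases b)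
      (auto simp: quaternion_defs biquat_of_real_quat_def complex_eq_iff)
  show ?thesis
    unfolding eq by auto
qed

end

theory Submission
  imports Defs
begin

text \<open>The semi-norm is a complex quadratic form whose polar form restricts to twice the inner
  product on real quaternions. Since I squares to -1, expanding it at a + I b gives real part |a| -
  |b| and imaginary part 2<a,b> (\<open>quat_norm_biquat\<close>). Its vanishing is thus two real
  equations, exactly the two conditions.\<close>

lemma quat_norm_biquat:
  "quat_norm (biquat_of_real_quat a + biquat_I * biquat_of_real_quat b)
     = Complex (quat_norm a - quat_norm b) (2 * quat_inner a b)"
  \<comment> \<open>In each coordinate this is (s + I t)^2 = s^2 - t^2 + 2 I s t with s, t real; the
    four are summed.\<close>
  by (cases a; cases b)
    (simp add: quat_norm_def quat_inner_def biquat_of_real_quat_def quaternion_defs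
      complex_eq_iff power2_eq_square algebra_simps)

theorem proposition1:
  fixes q :: biquaternion and W X Y Z :: complex and q\<^sub>r q\<^sub>i :: real_quaternion
  assumes "q = quat_of_scalar W + quat_of_scalar X * quat_i
             + quat_of_scalar Y * quat_j + quat_of_scalar Z * quat_k"
    and "q \<noteq> 0"
    and "q = biquat_of_real_quat q\<^sub>r + biquat_I * biquat_of_real_quat q\<^sub>i"
  shows "quat_norm q = W\<^sup>2 + X\<^sup>2 + Y\<^sup>2 + Z\<^sup>2 \<and>
    (quat_norm q\<^sub>r = quat_norm q\<^sub>i \<and> quat_inner q\<^sub>r q\<^sub>i = 0 \<longleftrightarrow> quat_norm q = 0)"
proof
  show "quat_norm q = W\<^sup>2 + X\<^sup>2 + Y\<^sup>2 + Z\<^sup>2"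
    using assms(1) by (simp add: quaternion_basis_form quat_norm_def)
  show "quat_norm q\<^sub>r = quat_norm q\<^sub>i \<and> quat_inner q\<^sub>r q\<^sub>i = 0 \<longleftrightarrow> quat_norm q = 0"
    \<comment> \<open>Real and imaginary parts are compared with 0; the factor 2 cancels.\<close>
    unfolding assms(3) quat_norm_biquat by (simp add: complex_eq_iff)
qed

end
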